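(* Let $\ell\le 0\le r$ be integers and let $(n_i)_{\ell\le i\le r}$ be a sequence of positive integers. The number of embedded rooted Cayley trees having vertical profile $(n_\ell,\ldots,n_{-1};n_0,n_1,\ldots,n_r)$ is $$\frac{n_0}{n_\ell n_r}\,\frac{n!}{\prod_{i=\ell}^r (n_i-1)!}\prod_{i=\ell}^{r}(n_{i-1}+n_{i+1})^{n_i-1},$$ where $n=\sum_i n_i$ and $n_{\ell-1}=n_{r+1}=0$.
   Context: A rooted Cayley tree of size $n$ is a tree (acyclic connected graph) on the vertex set $\{1,\ldots,n\}$ with a distinguished vertex $\rho$, the root. An embedding of such a tree in $\mathbb{Z}$ is a map $a:\{1,\ldots,n\}\to\mathbb{Z}$ with $a(\rho)=0$ and $|a(v)-a(v')|=1$ whenever $v,v'$ are neighbours; an embedded rooted Cayley tree is a pair (tree, embedding), and pairs are counted as distinct whenever the tree or the map differs. The vertical profile is $(n_\ell,\ldots,n_{-1};n_0,\ldots,n_r)$, where $n_i$ is the number of vertices with $a(v)=i$ and $\ell$ (resp. $r$) is the smallest (resp. largest) abscissa occurring. *)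

theory Defs
  imports Complex_Main "HOL-Library.FuncSet" "Graph_Theory.Graph_Theory"
begin

text \<open>
  Undirected simple graphs are represented by \<^locale>\<open>pair_graph\<close>: finite, loop-free, symmetric
  arc relations, each edge being a pair of opposite arcs. Such a pair of arcs already forms a
  library cycle of length 2, so the library predicate \<^const>\<open>forest\<close> fails for every graph with an
  edge (and on asymmetric digraphs it forbids only directed cycles). Undirected cycles
  are the library cycles of length at least 3.
\<close>

definition undirected_tree :: "'a pair_pre_digraph \<Rightarrow> bool" where
  "undirected_tree G \<longleftrightarrow> pair_graph G \<and> Digraph_Component.connected (with_proj G) \<and>
     \<not> (\<exists>p. pre_digraph.cycle (with_proj G) p \<and> 3 \<le> length p)"

definition rooted_cayley_tree :: "nat \<Rightarrow> nat pair_pre_digraph \<Rightarrow> nat \<Rightarrow> bool" where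
  "rooted_cayley_tree n G \<rho> \<longleftrightarrow> undirected_tree G \<and> pverts G = {1..n} \<and> \<rho> \<in> pverts G"

text \<open>
  Extensionality makes functions on \<^typ>\<open>nat\<close> correspond one-to-one to maps defined on the vertex
  set only, so that counting them is meaningful.
\<close>

definition tree_embedding :: "nat pair_pre_digraph \<Rightarrow> nat \<Rightarrow> (nat \<Rightarrow> int) \<Rightarrow> bool" where
  "tree_embedding G \<rho> a \<longleftrightarrow> a \<in> extensional (pverts G) \<and> a \<rho> = 0 \<and>
     (\<forall>(v, v') \<in> parcs G. \<bar>a v - a v'\<bar> = 1)"

definition embedded_rooted_cayley_trees :: "((nat pair_pre_digraph \<times> nat) \<times> (nat \<Rightarrow> int)) set" where
  "embedded_rooted_cayley_trees =
     {((G, \<rho>), a). (\<exists>n. rooted_cayley_tree n G \<rho>) \<and> tree_embedding G \<rho> a}"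

definition has_vertical_profile ::
    "nat pair_pre_digraph \<Rightarrow> (nat \<Rightarrow> int) \<Rightarrow> int \<Rightarrow> int \<Rightarrow> (int \<Rightarrow> nat) \<Rightarrow> bool" where
  "has_vertical_profile G a l r N \<longleftrightarrow>
     Min (a ` pverts G) = l \<and> Max (a ` pverts G) = r \<and>
     (\<forall>i \<in> {l..r}. card {v \<in> pverts G. a v = i} = N i)"

end

theory Submission
  imports Defs "HOL-Combinatorics.Multiset_Permutations"
begin

text \<open>
  An embedded rooted tree consists of an abscissa map with the prescribed fibres (a multinomial
  number of choices), a root among the \<open>n\<^sub>0\<close> vertices at \<open>0\<close>, and a spanning tree of the graph
  joining all vertices at distance one. Rooted at a vertex of abscissa \<open>l\<close> instead, such a
  spanning tree is an acyclic parent map that sends a vertex at \<open>i\<close> to one of the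
  \<open>n\<^sub>i\<^sub>-\<^sub>1 + n\<^sub>i\<^sub>+\<^sub>1\<close> vertices at \<open>i - 1\<close> or \<open>i + 1\<close>.

  If two vertices \<open>u\<close>, \<open>w\<close> have the same set \<open>X\<close> of admissible parents, then the number of acyclic
  parent maps is \<open>|X|\<close> times the number of those in which the parent of \<open>u\<close> is forced to be \<open>w\<close>.
  Iterating this within each level produces the factors \<open>(n\<^sub>i\<^sub>-\<^sub>1 + n\<^sub>i\<^sub>+\<^sub>1)\<close> to the power \<open>n\<^sub>i - 1\<close>
  and leaves a choice for one representative per level only, where acyclicity forces
  all representatives to point towards the root.
\<close>

section \<open>Acyclic maps\<close>

definition map_arcs :: "'a set \<Rightarrow> ('a \<Rightarrow> 'a) \<Rightarrow> 'a rel" where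
  "map_arcs D f = (\<lambda>v. (v, f v)) ` D"

text \<open>In the applications \<open>D\<close> is a finite vertex set without its root, so
  iterating an acyclic map must leave \<open>D\<close> at the root: these are parent maps.\<close>

definition acyclic_maps :: "'a set \<Rightarrow> ('a \<Rightarrow> 'a set) \<Rightarrow> ('a \<Rightarrow> 'a) set" where
  "acyclic_maps D T = {f \<in> Pi\<^sub>E D T. acyclic (map_arcs D f)}"

lemma map_arcs_iff: "(x, y) \<in> map_arcs D f \<longleftrightarrow> x \<in> D \<and> y = f x"
  by (auto simp: map_arcs_def)

text \<open>Applied to two target families that differ only at \<open>u\<close>, this reduces their
  comparison to one for each fixed map \<open>g\<close> on the other vertices.\<close>

lemma card_acyclic_maps_insert2:
  assumes D: "finite D" "u \<noteq> w" "u \<notin> D" "w \<notin> D"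
    and T: "\<And>v. v \<in> insert u (insert w D) \<Longrightarrow> finite (T v)"
  shows "card (acyclic_maps (insert u (insert w D)) T) =
    (\<Sum>g \<in> Pi\<^sub>E D T. card {(x, y) \<in> T u \<times> T w. acyclic (insert (u, x) (insert (w, y) (map_arcs D g)))})"
    (is "card ?A = (\<Sum>g \<in> _. card (?P g))")
proof -
  define h where "h = (\<lambda>(g, (x, y)). (g :: 'a \<Rightarrow> 'a)(w := y, u := x))"
  have arcs: "map_arcs (insert u (insert w D)) (g(w := y, u := x)) = insert (u, x) (insert (w, y) (map_arcs D g))"
    for g x y
    using D by (auto simp: map_arcs_def)
  have "bij_betw h (SIGMA g:Pi\<^sub>E D T. ?P g) ?A"
  proof (rule bij_betw_byWitness[where f' = "\<lambda>f. (restrict f D, (f u, f w))"])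
    show "\<forall>p\<in>SIGMA g:Pi\<^sub>E D T. ?P g. (restrict (h p) D, (h p u, h p w)) = p"
      using D by (auto simp: h_def fun_eq_iff PiE_iff extensional_def)
    show "\<forall>f\<in>?A. h (restrict f D, (f u, f w)) = f"
      using D by (auto simp: h_def fun_eq_iff acyclic_maps_def PiE_iff extensional_def)
    show "h ` (SIGMA g:Pi\<^sub>E D T. ?P g) \<subseteq> ?A"
      using D by (auto simp: h_def acyclic_maps_def arcs PiE_iff extensional_def)
    have "map_arcs (insert u (insert w D)) f = insert (u, f u) (insert (w, f w) (map_arcs D (restrict f D)))" for f
      by (auto simp: map_arcs_def)
    then show "(\<lambda>f. (restrict f D, (f u, f w))) ` ?A \<subseteq> (SIGMA g:Pi\<^sub>E D T. ?P g)"
      by (auto simp: acyclic_maps_def)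
  qed
  then have "card ?A = card (SIGMA g:Pi\<^sub>E D T. ?P g)"
    by (simp add: bij_betw_same_card)
  also have "\<dots> = (\<Sum>g \<in> Pi\<^sub>E D T. card (?P g))"
  proof (rule card_SigmaI)
    show "finite (Pi\<^sub>E D T)" using D T by (intro finite_PiE) auto
    have "finite (T u \<times> T w)" using T by auto
    then show "\<forall>g\<in>Pi\<^sub>E D T. finite (?P g)" by (auto intro: finite_subset[rotated])
  qed
  finally show ?thesis .
qed

text \<open>Split by \<open>x\<close>: outside \<open>W\<close> it lies in \<open>T - U - W\<close>
  and \<open>y\<close> ranges over \<open>T - W\<close>; inside \<open>W\<close> it forces
  \<open>y\<close> into \<open>T - U - W\<close>.\<close>

lemma card_pairs_avoiding:
  assumes "finite T" "U \<inter> W = {}"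
  shows "card {(x, y) \<in> T \<times> T. y \<notin> W \<and> x \<notin> U \<and> \<not> (x \<in> W \<and> y \<in> U)} = card T * card (T - U - W)"
proof -
  let ?R = "T - U - W"
  have "{(x, y) \<in> T \<times> T. y \<notin> W \<and> x \<notin> U \<and> \<not> (x \<in> W \<and> y \<in> U)} = ?R \<times> (T - W) \<union> (T \<inter> W) \<times> ?R"
    using assms(2) by auto
  also have "card \<dots> = card ?R * card (T - W) + card (T \<inter> W) * card ?R"
    using assms(1) by (subst card_Un_disjoint) (auto simp: card_cartesian_product)
  also have "\<dots> = (card (T - W) + card (T \<inter> W)) * card ?R"
    by (simp add: algebra_simps)
  also have "card (T - W) + card (T \<inter> W) = card T"
    using assms(1) by (metis add.commute card_Int_Diff)
  finally show ?thesis .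
qed

lemma single_valued_rtrancl_sinks:
  assumes "single_valued R" "(x, u) \<in> R\<^sup>*" "(x, w) \<in> R\<^sup>*" "u \<notin> Domain R" "w \<notin> Domain R"
  shows "u = w"
  using single_valued_confluent[OF assms(1-3)] assms(4,5) by (metis Not_Domain_rtrancl)

text \<open>
  Fix the map outside \<open>u\<close> and \<open>w\<close>, and let \<open>U\<close>, \<open>W\<close> be the sets of vertices that it leads to
  \<open>u\<close>, \<open>w\<close>. A pair of images \<open>(x, y)\<close> of \<open>(u, w)\<close> in the common target set \<open>X\<close> closes no cycle iff
  \<open>x \<notin> U\<close>, \<open>y \<notin> W\<close> and not both \<open>x \<in> W\<close>, \<open>y \<in> U\<close>. There are \<open>|X| |X - U - W|\<close> such pairs, while
  sending \<open>u\<close> to \<open>w\<close> leaves \<open>|X - U - W|\<close> images for \<open>w\<close>.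
\<close>

lemma card_acyclic_maps_merge:
  assumes D: "finite D" "u \<in> D" "w \<in> D" "u \<noteq> w"
    and T: "\<And>v. v \<in> D \<Longrightarrow> finite (T v)" "T u = T w"
  shows "card (acyclic_maps D T) = card (T u) * card (acyclic_maps D (T(u := {w})))"
proof -
  define D' where "D' = D - {u, w}"
  have D': "D = insert u (insert w D')" "u \<notin> D'" "w \<notin> D'" "finite D'"
    using D by (auto simp: D'_def)
  have PiE_eq: "Pi\<^sub>E D' (T(u := {w})) = Pi\<^sub>E D' T"
    using D' by (intro PiE_cong) auto
  have "card {(x, y) \<in> T u \<times> T w. acyclic (insert (u, x) (insert (w, y) (map_arcs D' g)))} =
      card (T u) * card {(x, y) \<in> (T(u := {w})) u \<times> (T(u := {w})) w.
        acyclic (insert (u, x) (insert (w, y) (map_arcs D' g)))}" (is "card ?L = _ * card ?R") for g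
  proof -
    define R where "R = map_arcs D' g"
    have sinks: "u \<notin> Domain R" "w \<notin> Domain R"
      using D' by (auto simp: R_def map_arcs_def)
    have sv: "single_valued R"
      by (auto simp: R_def single_valued_def map_arcs_def)
    define U W where "U = {x. (x, u) \<in> R\<^sup>*}" and "W = {x. (x, w) \<in> R\<^sup>*}"
    have disj: "U \<inter> W = {}"
      using single_valued_rtrancl_sinks[OF sv _ _ sinks] D(4) by (auto simp: U_def W_def)
    have uU: "u \<in> U" and wW: "w \<in> W" by (auto simp: U_def W_def)
    \<comment> \<open>A path from \<open>x\<close> to \<open>u\<close> either stays in
      \<open>R\<close> or uses the new arc \<open>(w, y)\<close>, which needs
      \<open>x \<in> W\<close> and \<open>y \<in> U\<close>.\<close>
    have iff: "acyclic (insert (u, x) (insert (w, y) R)) \<longleftrightarrow>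
        acyclic R \<and> y \<notin> W \<and> x \<notin> U \<and> \<not> (x \<in> W \<and> y \<in> U)" for x y
      by (auto simp: rtrancl_insert U_def W_def)
    show ?thesis
    proof (cases "acyclic R")
      case False
      then show ?thesis by (simp add: iff del: acyclic_insert flip: R_def)
    next
      case True
      have "?L = {(x, y) \<in> T u \<times> T u. y \<notin> W \<and> x \<notin> U \<and> \<not> (x \<in> W \<and> y \<in> U)}"
        using True T(2) by (simp add: iff del: acyclic_insert flip: R_def)
      \<comment> \<open>Since \<open>x = w\<close> lies in \<open>W\<close> and not in
        \<open>U\<close>, the mixed condition turns into \<open>y \<notin> U\<close>.\<close>
      moreover have "?R = {w} \<times> (T u - U - W)"
        using True T(2) D(4) disj wW by (auto simp: iff simp del: acyclic_insert simp flip: R_def)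
      ultimately show ?thesis
        using card_pairs_avoiding[OF _ disj, of "T u"] T(1) D
        by (simp add: card_cartesian_product)
    qed
  qed
  note pairs = this
  have finT: "finite (T v)" "finite ((T(u := {w})) v)" if "v \<in> insert u (insert w D')" for v
    using that T(1) D'(1) by auto
  have "card (acyclic_maps D T) = (\<Sum>g \<in> Pi\<^sub>E D' T.
      card {(x, y) \<in> T u \<times> T w. acyclic (insert (u, x) (insert (w, y) (map_arcs D' g)))})"
    unfolding D'(1) by (rule card_acyclic_maps_insert2[OF D'(4) D(4) D'(2,3) finT(1)])
  also have "\<dots> = card (T u) * (\<Sum>g \<in> Pi\<^sub>E D' T. card {(x, y) \<in> (T(u := {w})) u \<times> (T(u := {w})) w.
      acyclic (insert (u, x) (insert (w, y) (map_arcs D' g)))})"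
    unfolding sum_distrib_left by (intro sum.cong refl pairs)
  also have "(\<Sum>g \<in> Pi\<^sub>E D' T. card {(x, y) \<in> (T(u := {w})) u \<times> (T(u := {w})) w.
      acyclic (insert (u, x) (insert (w, y) (map_arcs D' g)))}) = card (acyclic_maps D (T(u := {w})))"
    unfolding D'(1) PiE_eq[symmetric]
    by (rule card_acyclic_maps_insert2[OF D'(4) D(4) D'(2,3) finT(2), symmetric])
  finally show ?thesis .
qed

text \<open>The vertices of \<open>S\<close> are merged into \<open>w\<close> one by one.
  \<open>w\<close> keeps its target set, so the next vertex still shares it and contributes the same
  factor.\<close>

lemma card_acyclic_maps_merge_class:
  assumes D: "finite D" "S \<subseteq> D" "w \<in> D" "w \<notin> S"
    and T: "\<And>v. v \<in> D \<Longrightarrow> finite (T v)" "\<And>u. u \<in> S \<Longrightarrow> T u = T w"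
  shows "card (acyclic_maps D T) =
    card (T w) ^ card S * card (acyclic_maps D (\<lambda>v. if v \<in> S then {w} else T v))"
proof -
  have "finite S" using D finite_subset by blast
  then show ?thesis using D(2,4) T(2)
  proof (induction S)
    case (insert u S)
    let ?T = "\<lambda>v. if v \<in> S then {w} else T v"
    have "card (acyclic_maps D ?T) = card (?T u) * card (acyclic_maps D (?T(u := {w})))"
      using insert T(1) D by (intro card_acyclic_maps_merge) auto
    moreover have "?T(u := {w}) = (\<lambda>v. if v \<in> insert u S then {w} else T v)"
      by (auto simp: fun_eq_iff)
    moreover have "?T u = T w" using insert by auto
    ultimately show ?case using insert by simp
  qed simp
qed

text \<open>Targets depend only on the class \<open>c v\<close>. \<open>J\<close> holds the classes
  already merged, so that induction on \<open>J\<close> treats one class at a time; the others still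
  have their original targets.\<close>

lemma card_acyclic_maps_merge_classes:
  assumes D: "finite D" and rep: "\<And>i. i \<in> J \<Longrightarrow> rep i \<in> D \<and> c (rep i) = i" and J: "finite J"
    and X: "\<And>v. v \<in> D \<Longrightarrow> finite (X (c v))"
  shows "card (acyclic_maps D (\<lambda>v. X (c v))) =
    (\<Prod>i\<in>J. card (X i) ^ (card {v \<in> D. c v = i} - 1)) *
    card (acyclic_maps D (\<lambda>v. if c v \<in> J \<and> v \<noteq> rep (c v) then {rep (c v)} else X (c v)))"
  using J rep
proof (induction J)
  case (insert j J)
  let ?T = "\<lambda>v. if c v \<in> J \<and> v \<noteq> rep (c v) then {rep (c v)} else X (c v)"
  let ?S = "{v \<in> D. c v = j} - {rep j}"
  let ?T' = "\<lambda>v. if c v \<in> insert j J \<and> v \<noteq> rep (c v) then {rep (c v)} else X (c v)"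
  have rep: "rep j \<in> D" "c (rep j) = j" using insert by auto
  have "card (acyclic_maps D ?T) = card (?T (rep j)) ^ card ?S *
      card (acyclic_maps D (\<lambda>v. if v \<in> ?S then {rep j} else ?T v))"
    using D rep insert X by (intro card_acyclic_maps_merge_class) auto
  also have "card ?S = card {v \<in> D. c v = j} - 1"
    using rep by simp
  also have "?T (rep j) = X j" using rep insert by simp
  also have "acyclic_maps D (\<lambda>v. if v \<in> ?S then {rep j} else ?T v) = acyclic_maps D ?T'"
    unfolding acyclic_maps_def by (intro arg_cong2[where f = "\<lambda>A P. {f \<in> A. P f}"] PiE_cong refl) auto
  finally show ?case using insert by simp
qed simp

section \<open>Acyclic maps between neighbouring levels\<close>

text \<open>The shifted product consists of \<open>N (l + 1)\<close> to \<open>N (r - 1)\<close>,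
  and the endpoints complete it. This is the source of the denominator in the final formula.\<close>

lemma prod_shift_endpoints:
  fixes N :: "int \<Rightarrow> nat"
  assumes "l < r"
  shows "N l * N r * (\<Prod>i=l+1..r. if i = l + 1 then 1 else N (i - 1)) = (\<Prod>i=l..r. N i)"
proof -
  have "l + 1 \<le> r" using assms by simp
  then show ?thesis
  proof (induction r rule: int_ge_induct)
    case base
    have "{l..l+1} = {l, l+1}" by auto
    then show ?case by simp
  next
    case (step r)
    have "{l+1..r+1} = insert (r+1) {l+1..r}" "{l..r+1} = insert (r+1) {l..r}"
      using step by auto
    then show ?case using step by (simp add: algebra_simps)
  qed
qed

text \<open>
  Once every non-representative points to the representative of its level, no two neighbouring
  representatives may point to each other's level. The representative of level \<open>r\<close> must go down,
  hence so must all others above level \<open>l\<close>, and the one of level \<open>l + 1\<close> must go to the root itself.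
  Level \<open>l\<close> has no representative if the root is its only vertex.
\<close>

lemma card_level_maps:
  fixes lev :: "'a \<Rightarrow> int"
  defines "N \<equiv> \<lambda>V i. card {v \<in> V. lev v = i}"
  assumes V: "finite V" "lev ` V \<subseteq> {l..r}" "\<And>i. i \<in> {l..r} \<Longrightarrow> 0 < N V i"
    and \<rho>: "\<rho> \<in> V" "lev \<rho> = l"
  shows "N V l * N V r * card (acyclic_maps (V - {\<rho>}) (\<lambda>v. {x \<in> V. \<bar>lev v - lev x\<bar> = 1})) =
    (\<Prod>i=l..r. N V i) * (\<Prod>i=l..r. (N V (i - 1) + N V (i + 1)) ^ (N V i - 1))"
proof -
  define D where "D = V - {\<rho>}"
  define L where "L i = {v \<in> V. lev v = i}" for i
  define X where "X i = L (i - 1) \<union> L (i + 1)" for i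
  define J where "J = lev ` D"
  define rep where "rep i = (SOME v. v \<in> D \<and> lev v = i)" for i
  define T' where "T' v = (if lev v \<in> J \<and> v \<noteq> rep (lev v) then {rep (lev v)} else X (lev v))" for v
  \<comment> \<open>\<open>k i\<close> is what acyclicity leaves to the representative of level
    \<open>i\<close>. On level \<open>l\<close> it can only go up.\<close>
  define k where "k i = (if i = l then L (l + 1) else if i = l + 1 then {\<rho>} else L (i - 1))" for i
  define T'' where "T'' v = (if v \<noteq> rep (lev v) then {rep (lev v)} else k (lev v))" for v
  have lr: "l \<le> r" using V(2) \<rho> by auto
  have finL: "finite (L i)" for i using V by (simp add: L_def)
  have cardL: "card (L i) = N V i" for i by (simp add: L_def N_def)
  have cardX: "card (X i) = N V (i - 1) + N V (i + 1)" for i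
    unfolding X_def by (subst card_Un_disjoint) (auto simp: finL cardL, auto simp: L_def)
  have finD: "finite D" using V by (simp add: D_def)
  have finJ: "finite J" using finD by (simp add: J_def)
  have L_out: "L i = {}" if "i \<notin> {l..r}" for i using V(2) that by (auto simp: L_def)
  have repJ: "rep i \<in> D \<and> lev (rep i) = i" if "i \<in> J" for i
    using that unfolding J_def rep_def by (intro someI_ex[of "\<lambda>v. v \<in> D \<and> lev v = i"]) auto
  have JI: "i \<in> J" if "i \<in> {l+1..r}" for i
  proof -
    have "L i \<noteq> {}" using V(3)[of i] that cardL[of i] by auto
    then obtain v where "v \<in> L i" by auto
    then have "v \<in> D" "lev v = i" using that \<rho> by (auto simp: D_def L_def)
    then show ?thesis by (auto simp: J_def)
  qed
  have J_sub: "J \<subseteq> {l..r}" using V(2) by (auto simp: J_def D_def)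
  have LD: "L i \<subseteq> D" if "i \<noteq> l" for i using that \<rho> by (auto simp: L_def D_def)
  have Dlev: "lev v \<in> J" "lev v \<in> {l..r}" "v \<in> L (lev v)" if "v \<in> D" for v
    using that J_sub by (auto simp: J_def L_def D_def)
  have XT: "(\<lambda>v. {x \<in> V. \<bar>lev v - lev x\<bar> = 1}) = (\<lambda>v. X (lev v))"
    by (auto simp: X_def L_def fun_eq_iff)
  have "card (acyclic_maps D (\<lambda>v. X (lev v))) =
      (\<Prod>i\<in>J. card (X i) ^ (card {v \<in> D. lev v = i} - 1)) * card (acyclic_maps D T')"
    unfolding T'_def using finD repJ finJ
    by (intro card_acyclic_maps_merge_classes) (auto simp: X_def finL)
  also have "acyclic_maps D T' = Pi\<^sub>E D T''"
  proof (intro equalityI subsetI)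
    fix f assume f: "f \<in> Pi\<^sub>E D T''"
    \<comment> \<open>A rank that drops along every arc. Non-root vertices of level \<open>l\<close>
      get 4 or 5, above the values 2 and 3 of level \<open>l + 1\<close>, where their representative
      points; no other level points to them.\<close>
    define m :: "'a \<Rightarrow> int" where "m v = (if v = \<rho> then 0 else if lev v = l then (if v = rep l then 4 else 5)
      else 2 * (lev v - l) + (if v = rep (lev v) then 0 else 1))" for v
    have dec: "0 \<le> m (f v) \<and> m (f v) < m v" if v: "v \<in> D" for v
    proof -
      have v\<rho>: "v \<noteq> \<rho>" and lv: "l \<le> lev v" using v V(2) by (auto simp: D_def)
      have fv: "f v \<in> T'' v" using f v by auto
      have "lev v = l \<or> lev v = l + 1 \<or> lev v \<ge> l + 2" using lv by linarith
      then consider "v \<noteq> rep (lev v)" | "v = rep (lev v)" "lev v = l" | "v = rep (lev v)" "lev v = l + 1"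
        | "v = rep (lev v)" "lev v \<ge> l + 2" by blast
      then show ?thesis
      proof cases
        case 1
        then have "f v = rep (lev v)" using fv by (simp add: T''_def)
        moreover have "rep (lev v) \<noteq> \<rho>" "lev (rep (lev v)) = lev v"
          using repJ[OF Dlev(1)[OF v]] by (auto simp: D_def)
        ultimately show ?thesis using 1 v\<rho> lv by (auto simp: m_def)
      next
        case 2
        then have "lev (f v) = l + 1" using fv by (auto simp: T''_def k_def L_def)
        then show ?thesis using 2 v\<rho> \<rho> by (auto simp: m_def)
      next
        case 3
        then have "f v = \<rho>" using fv by (auto simp: T''_def k_def)
        then show ?thesis using 3 v\<rho> by (auto simp: m_def)
      next
        case 4
        then have "lev (f v) = lev v - 1" using fv by (auto simp: T''_def k_def L_def)
        then show ?thesis using 4 v\<rho> \<rho> by (auto simp: m_def)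
      qed
    qed
    have "(map_arcs D f)\<inverse> \<subseteq> measure (\<lambda>v. nat (m v))"
      using dec by (force simp: map_arcs_iff)
    then have "acyclic (map_arcs D f)"
      using wf_acyclic wf_subset wf_measure acyclic_converse by metis
    moreover have "T'' v \<subseteq> T' v" if "v \<in> D" for v
      using Dlev[OF that] \<rho> by (auto simp: T''_def T'_def k_def X_def L_def)
    ultimately show "f \<in> acyclic_maps D T'"
      using f PiE_mono[of D T'' T'] by (auto simp: acyclic_maps_def)
  next
    fix f assume "f \<in> acyclic_maps D T'"
    then have f: "f \<in> Pi\<^sub>E D T'" and acyc: "acyclic (map_arcs D f)"
      by (auto simp: acyclic_maps_def)
    let ?R = "map_arcs D f"
    have fT: "f v \<in> T' v" if "v \<in> D" for v using f that by (rule PiE_mem)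
    have to_rep: "(v, rep (lev v)) \<in> ?R\<^sup>*" if "v \<in> D" for v
    proof (cases "v = rep (lev v)")
      case False
      then have "f v = rep (lev v)" using fT[OF that] Dlev(1)[OF that] by (simp add: T'_def)
      then have "(v, rep (lev v)) \<in> ?R" using that by (simp add: map_arcs_iff)
      then show ?thesis by auto
    qed simp
    \<comment> \<open>Entering a level at a vertex of \<open>D\<close> leads on to its
      representative. The root has no outgoing arc, hence the condition
      \<open>f (rep i) \<in> D\<close>.\<close>
    have step: "(rep i, rep (lev (f (rep i)))) \<in> ?R\<^sup>+" if "i \<in> J" "f (rep i) \<in> D" for i
    proof -
      have "(rep i, f (rep i)) \<in> ?R" using repJ[OF that(1)] by (simp add: map_arcs_iff)
      then show ?thesis using to_rep[OF that(2)] by (rule rtrancl_into_trancl2)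
    qed
    have two: False if "i \<in> J" "j \<in> J" "f (rep i) \<in> D" "f (rep j) \<in> D"
      "lev (f (rep i)) = j" "lev (f (rep j)) = i" for i j
      using step[of i] step[of j] that acyc by (metis acyclic_def trancl_trans)
    have f_rep: "f (rep i) \<in> X i" if "i \<in> J" for i
      using fT[of "rep i"] repJ[OF that] by (simp add: T'_def)
    have down: "l + 1 \<le> i \<longrightarrow> f (rep i) \<in> L (i - 1)" if "i \<le> r" for i
      using that
    proof (induction i rule: int_le_induct)
      case base
      show ?case
      proof
        assume "l + 1 \<le> r"
        then have "f (rep r) \<in> X r" using JI f_rep by auto
        then show "f (rep r) \<in> L (r - 1)" using L_out[of "r + 1"] by (auto simp: X_def)
      qed
    next
      case (step i)
      show ?case
      proof
        assume i: "l + 1 \<le> i - 1"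
        have J: "i \<in> J" "i - 1 \<in> J" using i step.hyps by (auto intro: JI)
        have fi: "f (rep i) \<in> L (i - 1)" using step i by auto
        show "f (rep (i - 1)) \<in> L (i - 1 - 1)"
        proof (rule ccontr)
          assume "f (rep (i - 1)) \<notin> L (i - 1 - 1)"
          then have fi': "f (rep (i - 1)) \<in> L i" using f_rep[OF J(2)] by (auto simp: X_def)
          show False
            using two[OF J] fi fi' LD[of i] LD[of "i - 1"] i by (auto simp: L_def)
        qed
      qed
    qed
    \<comment> \<open>Another target on level \<open>l\<close> would give that level a
      representative, which must go up to level \<open>l + 1\<close> and close a cycle.\<close>
    have at_root: "f (rep (l + 1)) = \<rho>" if "l + 1 \<le> r"
    proof (rule ccontr)
      assume ne: "f (rep (l + 1)) \<noteq> \<rho>"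
      have "f (rep (l + 1)) \<in> L l" using down[of "l + 1"] that by simp
      then have f1: "f (rep (l + 1)) \<in> D" "lev (f (rep (l + 1))) = l"
        using ne by (auto simp: L_def D_def)
      then have lJ: "l \<in> J" using Dlev(1) by fastforce
      then have "f (rep l) \<in> L (l + 1)" using f_rep[OF lJ] L_out[of "l - 1"] by (auto simp: X_def)
      then have "f (rep l) \<in> D" "lev (f (rep l)) = l + 1" using LD[of "l + 1"] by (auto simp: L_def)
      then show False using two[OF lJ JI, of "l + 1"] f1 that by auto
    qed
    have "f v \<in> T'' v" if v: "v \<in> D" for v
    proof (cases "v = rep (lev v)")
      case False
      then show ?thesis using fT[OF v] Dlev(1)[OF v] by (simp add: T'_def T''_def)
    next
      case True
      have lv: "lev v \<in> J" "lev v \<in> {l..r}" using Dlev[OF v] by auto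
      have "f (rep (lev v)) \<in> k (lev v)"
        using down[of "lev v"] at_root f_rep[OF lv(1)] lv(2) L_out[of "l - 1"]
        by (cases "lev v = l"; cases "lev v = l + 1") (auto simp: k_def X_def)
      then show ?thesis using True by (simp add: T''_def)
    qed
    then show "f \<in> Pi\<^sub>E D T''" using f by (auto simp: PiE_iff)
  qed
  also have "card (Pi\<^sub>E D T'') = (\<Prod>v\<in>D. card (T'' v))"
    by (rule card_PiE[OF finD])
  also have "\<dots> = (\<Prod>v\<in>rep ` J. card (k (lev v)))"
  proof (rule prod.mono_neutral_cong_right[OF finD])
    show "rep ` J \<subseteq> D" using repJ by auto
    show "\<forall>v\<in>D - rep ` J. card (T'' v) = 1" using Dlev by (auto simp: T''_def)
    show "card (T'' v) = card (k (lev v))" if "v \<in> rep ` J" for v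
      using that repJ by (auto simp: T''_def)
  qed
  also have "\<dots> = (\<Prod>i\<in>J. card (k i))"
  proof -
    have "inj_on rep J" using repJ by (metis inj_onI)
    then show ?thesis using repJ by (simp add: prod.reindex)
  qed
  also have "(\<Prod>i\<in>J. card (X i) ^ (card {v \<in> D. lev v = i} - 1)) * (\<Prod>i\<in>J. card (k i)) =
      (\<Prod>i\<in>J. card (X i) ^ (card {v \<in> D. lev v = i} - 1) * card (k i))"
    by (simp add: prod.distrib)
  \<comment> \<open>Without the root, level \<open>l\<close> has \<open>N V l - 1\<close> vertices,
    so merging gives the exponent \<open>N V l - 2\<close>; the representative's own choice,
    \<open>card (k l) = card (X l)\<close>, restores the missing factor. If the root is alone there,
    \<open>l \<notin> J\<close> and the exponent \<open>N V l - 1\<close> is 0.\<close>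
  also have "\<dots> = (\<Prod>i=l+1..r. card (X i) ^ (N V i - 1) * card (k i)) * card (X l) ^ (N V l - 1)"
  proof -
    let ?w = "\<lambda>i. card (X i) ^ (card {v \<in> D. lev v = i} - 1) * card (k i)"
    have up: "(\<Prod>i=l+1..r. ?w i) = (\<Prod>i=l+1..r. card (X i) ^ (N V i - 1) * card (k i))"
    proof (rule prod.cong[OF refl])
      fix i assume "i \<in> {l+1..r}"
      then have "{v \<in> D. lev v = i} = L i" using \<rho> by (auto simp: D_def L_def)
      then show "?w i = card (X i) ^ (N V i - 1) * card (k i)" by (simp add: cardL)
    qed
    have "{v \<in> D. lev v = l} = L l - {\<rho>}" by (auto simp: D_def L_def)
    then have Dl: "card {v \<in> D. lev v = l} = N V l - 1"
      using \<rho> finL cardL by (simp add: L_def)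
    have kl: "card (k l) = card (X l)"
      using L_out[of "l - 1"] by (simp add: k_def X_def)
    have "{l..r} = insert l {l+1..r}" using lr by auto
    then have J_bounds: "{l+1..r} \<subseteq> J" "J \<subseteq> insert l {l+1..r}" using JI J_sub by auto
    show ?thesis
    proof (cases "l \<in> J")
      case True
      then have "{v \<in> D. lev v = l} \<noteq> {}" by (auto simp: J_def)
      moreover have "finite {v \<in> D. lev v = l}" using finD by simp
      ultimately have "N V l - 1 \<noteq> 0" unfolding Dl[symmetric] by (simp only: card_0_eq not_False_eq_True)
      then obtain m where m: "N V l - 1 = Suc m" using not0_implies_Suc by blast
      have "?w l = card (X l) ^ (N V l - 1)"
        unfolding Dl kl m by simp
      moreover have "J = insert l {l+1..r}" using True J_bounds by blast
      ultimately show ?thesis using up by (simp add: mult.commute)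
    next
      case False
      then have "{v \<in> D. lev v = l} = {}" by (auto simp: J_def)
      then have "N V l - 1 = 0" using Dl by (simp only: card.empty)
      moreover have "J = {l+1..r}" using False J_bounds by blast
      ultimately show ?thesis using up by simp
    qed
  qed
  finally have main: "card (acyclic_maps D (\<lambda>v. X (lev v))) =
    (\<Prod>i=l..r. card (X i) ^ (N V i - 1)) * (\<Prod>i=l+1..r. card (k i))"
  proof -
    have "{l..r} = insert l {l+1..r}" using lr by auto
    then have "(\<Prod>i=l..r. card (X i) ^ (N V i - 1)) =
        card (X l) ^ (N V l - 1) * (\<Prod>i=l+1..r. card (X i) ^ (N V i - 1))" by simp
    moreover assume "card (acyclic_maps D (\<lambda>v. X (lev v))) =
      (\<Prod>i=l+1..r. card (X i) ^ (N V i - 1) * card (k i)) * card (X l) ^ (N V l - 1)"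
    ultimately show ?thesis by (simp add: prod.distrib)
  qed
  have k: "(\<Prod>i=l+1..r. card (k i)) = (\<Prod>i=l+1..r. if i = l + 1 then 1 else N V (i - 1))"
    by (rule prod.cong) (auto simp: k_def cardL)
  have "N V l * N V r * card (acyclic_maps D (\<lambda>v. X (lev v))) =
    (\<Prod>i=l..r. N V i) * (\<Prod>i=l..r. card (X i) ^ (N V i - 1))"
  proof (cases "l = r")
    case True
    \<comment> \<open>A single level has no neighbours: the power of 0 is 1 if the root is the only
      vertex and 0 otherwise.\<close>
    have "card (X l) = 0" using L_out[of "l - 1"] L_out[of "l + 1"] True by (simp add: X_def)
    then show ?thesis using main True by (cases "N V l - 1") auto
  next
    case False
    then show ?thesis
      using lr prod_shift_endpoints[of l r "N V"] main k by (simp add: algebra_simps)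
  qed
  then show ?thesis
    unfolding XT D_def[symmetric] cardX .
qed

section \<open>Undirected trees as acyclic parent maps\<close>

definition tree_of_map :: "'a set \<Rightarrow> 'a \<Rightarrow> ('a \<Rightarrow> 'a) \<Rightarrow> 'a pair_pre_digraph" where
  "tree_of_map V \<rho> f =
    \<lparr>pverts = V, parcs = map_arcs (V - {\<rho>}) f \<union> (map_arcs (V - {\<rho>}) f)\<inverse>\<rparr>"

lemma tree_of_map_simps [simp]:
  "pverts (tree_of_map V \<rho> f) = V"
  "parcs (tree_of_map V \<rho> f) = map_arcs (V - {\<rho>}) f \<union> (map_arcs (V - {\<rho>}) f)\<inverse>"
  by (simp_all add: tree_of_map_def)

section \<open>Acyclic parent maps yield trees\<close>

lemma finite_map_arcs: "finite D \<Longrightarrow> finite (map_arcs D f)"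
  by (simp add: map_arcs_def)

lemma pair_graph_tree_of_map:
  assumes "finite V" "f \<in> acyclic_maps (V - {\<rho>}) (\<lambda>_. V)"
  shows "pair_graph (tree_of_map V \<rho> f)"
proof -
  have loop: "False" if "v = f v" "v \<in> V - {\<rho>}" for v
  proof -
    have "(v, v) \<in> map_arcs (V - {\<rho>}) f" using that by (simp add: map_arcs_iff)
    then show False using assms by (auto simp: acyclic_maps_def acyclic_def)
  qed
  show ?thesis
    using assms
    by unfold_locales (auto simp: acyclic_maps_def PiE_iff map_arcs_iff finite_map_arcs symmetric_def
        intro!: symI dest: loop)
qed

text \<open>Following parents is well-founded and ends at the root, so every vertex reaches it;
  symmetry of the arcs then joins any two vertices.\<close>

lemma reachable_tree_of_map:
  assumes V: "finite V" "\<rho> \<in> V" and f: "f \<in> acyclic_maps (V - {\<rho>}) (\<lambda>_. V)"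
    and "u \<in> V" "v \<in> V"
  shows "u \<rightarrow>\<^sup>*\<^bsub>with_proj (tree_of_map V \<rho> f)\<^esub> v"
proof -
  interpret pair_graph "tree_of_map V \<rho> f"
    by (rule pair_graph_tree_of_map[OF V(1) f])
  define R where "R = map_arcs (V - {\<rho>}) f"
  have "wf (R\<inverse>)"
    using V f by (intro finite_acyclic_wf_converse) (auto simp: R_def acyclic_maps_def finite_map_arcs)
  then have to_root: "x \<in> V \<longrightarrow> x \<rightarrow>\<^sup>*\<^bsub>with_proj (tree_of_map V \<rho> f)\<^esub> \<rho>" for x
  proof (induction x rule: wf_induct_rule)
    case (less x)
    show ?case
    proof (cases "x = \<rho>")
      case False
      show ?thesis
      proof
        assume "x \<in> V"
        then have arc: "(x, f x) \<in> R" and "f x \<in> V"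
          using False f by (auto simp: R_def map_arcs_iff acyclic_maps_def)
        then have "f x \<rightarrow>\<^sup>*\<^bsub>with_proj (tree_of_map V \<rho> f)\<^esub> \<rho>" using less by auto
        moreover have "(x, f x) \<in> parcs (tree_of_map V \<rho> f)" using arc by (simp add: R_def)
        ultimately show "x \<rightarrow>\<^sup>*\<^bsub>with_proj (tree_of_map V \<rho> f)\<^esub> \<rho>"
          by (meson adj_reachable_trans)
      qed
    qed (use V in simp)
  qed
  show ?thesis
    using to_root assms(4,5) symmetric_reachable' reachable_trans by blast
qed

lemma pcas_nth_Suc: "pcas u p w \<Longrightarrow> Suc i < length p \<Longrightarrow> fst (p ! Suc i) = snd (p ! i)"
proof (induction p arbitrary: u i)
  case (Cons e p)
  then show ?case by (cases i; cases p) auto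
qed simp

lemma pcas_ends: "pcas u p w \<Longrightarrow> p \<noteq> [] \<Longrightarrow> fst (p ! 0) = u \<and> snd (p ! (length p - 1)) = w"
proof (induction p arbitrary: u)
  case (Cons e p)
  then show ?case by (cases p) auto
qed simp

text \<open>\<open>j\<close> and \<open>k\<close> are the cyclic successor and predecessor of
  \<open>i\<close>, with wrap-around at both ends. They differ because the length is at least
  3.\<close>

lemma cycle_neighbours:
  assumes "pcas u p u" "3 \<le> length p" "i < length p"
  obtains j k where "j < length p" "k < length p" "j \<noteq> k"
    "fst (p ! j) = snd (p ! i)" "snd (p ! k) = fst (p ! i)"
proof -
  note Suc = pcas_nth_Suc[OF assms(1)] and ends = pcas_ends[OF assms(1)]
  have "p \<noteq> []" using assms by auto
  consider "i = 0" | m where "i = Suc m" "length p = Suc i" | m where "i = Suc m" "Suc i < length p"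
    using assms(2,3) by (cases i) force+
  then show thesis
  proof cases
    case 1
    then show thesis using that[of 1 "length p - 1"] Suc[of 0] ends assms \<open>p \<noteq> []\<close> by auto
  next
    case 2
    then show thesis using that[of 0 m] Suc[of m] ends assms \<open>p \<noteq> []\<close> by auto
  next
    case 3
    then show thesis using that[of "Suc i" m] Suc[of i] Suc[of m] assms by auto
  qed
qed

text \<open>
  On an undirected cycle, pick a vertex that is the parent of no other vertex of the cycle: both of
  its neighbours on the cycle would be its parent.
\<close>

lemma undirected_tree_tree_of_map:
  assumes V: "finite V" "\<rho> \<in> V" and f: "f \<in> acyclic_maps (V - {\<rho>}) (\<lambda>_. V)"
  shows "undirected_tree (tree_of_map V \<rho> f)"
  unfolding undirected_tree_def
proof (intro conjI notI)
  let ?G = "tree_of_map V \<rho> f"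
  show "pair_graph ?G" by (rule pair_graph_tree_of_map[OF V(1) f])
  then interpret pair_graph ?G .
  show "Digraph_Component.connected (with_proj ?G)"
    unfolding Digraph_Component.connected_def
  proof (rule strongly_connectedI)
    fix u v assume "u \<in> verts (with_proj (mk_symmetric (with_proj ?G)))"
      "v \<in> verts (with_proj (mk_symmetric (with_proj ?G)))"
    then show "u \<rightarrow>\<^sup>*\<^bsub>with_proj (mk_symmetric (with_proj ?G))\<^esub> v"
      using reachable_tree_of_map[OF V f] by (intro reachable_mk_symmetricI) auto
  qed (use V in auto)
  assume "\<exists>p. cycle p \<and> 3 \<le> length p"
  then obtain p u where p: "3 \<le> length p" "awalk u p u" "distinct (tl (pawalk_verts u p))"
    by (auto simp: cycle_def)
  define R where "R = map_arcs (V - {\<rho>}) f"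
  have cas: "pcas u p u" and arcs: "set p \<subseteq> R \<union> R\<inverse>"
    using p by (auto simp: awalk_def R_def)
  have "p \<noteq> []" using p(1) by auto
  have dist: "distinct (map snd p)"
    using p(3) awalk_verts_conv'[OF cas] \<open>p \<noteq> []\<close> by simp
  have "wf R"
    using V f by (intro finite_acyclic_wf) (auto simp: R_def acyclic_maps_def finite_map_arcs)
  have "snd (p ! 0) \<in> snd ` set p" using \<open>p \<noteq> []\<close> by auto
  then obtain v where v: "v \<in> snd ` set p" "\<And>y. (y, v) \<in> R \<Longrightarrow> y \<notin> snd ` set p"
    by (rule wfE_min[OF \<open>wf R\<close>]) blast
  then obtain i where i: "i < length p" "v = snd (p ! i)"
    by (auto simp: in_set_conv_nth)
  obtain j k where jk: "j < length p" "k < length p" "j \<noteq> k"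
    "fst (p ! j) = snd (p ! i)" "snd (p ! k) = fst (p ! i)"
    using cycle_neighbours[OF cas p(1) i(1)] .
  have "(fst (p ! i), v) \<in> R \<union> R\<inverse>" "(v, snd (p ! j)) \<in> R \<union> R\<inverse>"
    using arcs i jk by (metis nth_mem prod.collapse subsetD)+
  moreover have "fst (p ! i) \<in> snd ` set p" "snd (p ! j) \<in> snd ` set p"
    using jk by (metis image_eqI nth_mem)+
  ultimately have "(v, fst (p ! i)) \<in> R" "(v, snd (p ! j)) \<in> R"
    using v(2) by blast+
  then have "snd (p ! k) = snd (p ! j)"
    using jk by (simp add: R_def map_arcs_iff)
  then show False
    using dist jk by (simp add: distinct_conv_nth)
qed

text \<open>Induction outwards from the root. If \<open>f v\<close> is not the parent of
  \<open>v\<close> under \<open>g\<close>, then the shared edge forces \<open>g (f v) = v\<close>;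
  by induction \<open>f (f v) = v\<close>, a cycle of length 2.\<close>

lemma tree_of_map_inj:
  assumes V: "finite V"
    and f: "f \<in> acyclic_maps (V - {\<rho>}) (\<lambda>_. V)" and g: "g \<in> acyclic_maps (V - {\<rho>}) (\<lambda>_. V)"
    and eq: "tree_of_map V \<rho> f = tree_of_map V \<rho> g"
  shows "f = g"
proof -
  define R where "R = map_arcs (V - {\<rho>}) f"
  have acyc: "acyclic R" using f by (simp add: R_def acyclic_maps_def)
  have "wf (R\<inverse>)"
    using V acyc by (intro finite_acyclic_wf_converse) (auto simp: R_def finite_map_arcs)
  then have "v \<in> V - {\<rho>} \<longrightarrow> f v = g v" for v
  proof (induction v rule: wf_induct_rule)
    case (less v)
    show ?case
    proof (intro impI, rule ccontr)
      assume v: "v \<in> V - {\<rho>}" and ne: "f v \<noteq> g v"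
      then have arc: "(v, f v) \<in> R" by (simp add: R_def map_arcs_iff)
      then have "(v, f v) \<in> parcs (tree_of_map V \<rho> g)"
        unfolding eq[symmetric] by (simp add: R_def)
      then have fv: "f v \<in> V - {\<rho>}" "g (f v) = v"
        using ne by (auto simp: map_arcs_iff)
      then have "f (f v) = v" using less arc by auto
      then have "(f v, v) \<in> R" using fv by (simp add: R_def map_arcs_iff)
      then have "(v, v) \<in> R\<^sup>+" using arc by auto
      then show False using acyc by (simp add: acyclic_def)
    qed
  qed
  then show ?thesis
    using f g by (intro PiE_ext[of f "V - {\<rho>}" "\<lambda>_. V" g]) (auto simp: acyclic_maps_def)
qed

text \<open>Let \<open>f\<close> send each vertex to a neighbour strictly closer to the root. Its
  tree is a connected spanning subgraph of \<open>G\<close>, so any further arc of \<open>G\<close>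
  would close an undirected cycle.\<close>

lemma undirected_tree_eq_tree_of_map:
  assumes G: "undirected_tree G" and \<rho>: "\<rho> \<in> pverts G"
  obtains f where "f \<in> acyclic_maps (pverts G - {\<rho>}) (\<lambda>_. pverts G)" "G = tree_of_map (pverts G) \<rho> f"
proof -
  let ?V = "pverts G"
  interpret pair_graph G using G by (simp add: undirected_tree_def)
  have conn: "strongly_connected (with_proj G)"
    using G pair_sym_arcs by (intro symmetric_connected_imp_strongly_connected) (auto simp: undirected_tree_def)
  define d where "d v = (LEAST n. (v, \<rho>) \<in> parcs G ^^ n)" for v
  have "\<exists>y. (v, y) \<in> parcs G \<and> d y < d v" if v_in: "v \<in> ?V - {\<rho>}" for v
  proof -
    have "v \<rightarrow>\<^sup>*\<^bsub>with_proj G\<^esub> \<rho>" using conn v_in \<rho> by (auto simp: strongly_connected_def)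
    then have "(v, \<rho>) \<in> (parcs G)\<^sup>*" using reachable_rtranclI by fastforce
    then have "\<exists>n. (v, \<rho>) \<in> parcs G ^^ n" by (simp add: rtrancl_power)
    then have v: "(v, \<rho>) \<in> parcs G ^^ d v" unfolding d_def by (rule LeastI_ex)
    then obtain m where m: "d v = Suc m" using v_in by (cases "d v") auto
    then obtain y where y: "(v, y) \<in> parcs G" "(y, \<rho>) \<in> parcs G ^^ m"
      using v by (metis relpow_Suc_D2)
    then have "d y \<le> m" unfolding d_def by (intro Least_le)
    then show ?thesis using y m by auto
  qed
  then obtain h where h: "\<And>v. v \<in> ?V - {\<rho>} \<Longrightarrow> (v, h v) \<in> parcs G \<and> d (h v) < d v"
    by metis
  define f where "f = restrict h (?V - {\<rho>})"
  have f: "(v, f v) \<in> parcs G" "d (f v) < d v" if "v \<in> ?V - {\<rho>}" for v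
    using h that by (auto simp: f_def)
  have "(map_arcs (?V - {\<rho>}) f)\<inverse> \<subseteq> measure d"
    using f by (auto simp: map_arcs_iff)
  then have "acyclic ((map_arcs (?V - {\<rho>}) f)\<inverse>)"
    using wf_acyclic wf_subset wf_measure by metis
  then have f_maps: "f \<in> acyclic_maps (?V - {\<rho>}) (\<lambda>_. ?V)"
    using f by (auto simp: acyclic_maps_def f_def dest: in_arcsD2)
  let ?H = "tree_of_map ?V \<rho> f"
  interpret H: pair_graph ?H by (rule pair_graph_tree_of_map[OF pair_finite_verts f_maps])
  have sub: "parcs ?H \<subseteq> parcs G"
    using f(1) arcs_symmetric by (auto simp: map_arcs_iff)
  have "parcs G \<subseteq> parcs ?H"
  proof (rule ccontr)
    assume "\<not> parcs G \<subseteq> parcs ?H"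
    then obtain x y where xy: "(x, y) \<in> parcs G" "(x, y) \<notin> parcs ?H" by auto
    have "y \<rightarrow>\<^sup>*\<^bsub>with_proj ?H\<^esub> x"
      using xy wellformed' by (intro reachable_tree_of_map[OF pair_finite_verts \<rho> f_maps]) auto
    then obtain p where p: "H.apath y p x" by (auto simp: H.reachable_apath)
    then have pH: "set p \<subseteq> parcs ?H" "pcas y p x" "distinct (pawalk_verts y p)"
      by (auto simp: H.apath_def H.awalk_def)
    have "awalk x ((x, y) # p) x"
      using pH sub xy in_arcsD1 by (auto simp: awalk_def)
    then have "cycle ((x, y) # p)"
      using pH by (auto simp: cycle_def)
    \<comment> \<open>An empty \<open>p\<close> would make \<open>(x, y)\<close> a loop, and a
      single arc would be its reverse, already in \<open>?H\<close>.\<close>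
    moreover have "3 \<le> length ((x, y) # p)"
    proof (rule ccontr)
      assume "\<not> ?thesis"
      then consider "p = []" | e where "p = [e]" by (cases p; cases "tl p") auto
      then show False
      proof cases
        case 1
        then show False using pH xy no_loops' by auto
      next
        case 2
        then have "(y, x) \<in> parcs ?H" using pH by auto
        then show False using xy(2) H.arcs_symmetric by blast
      qed
    qed
    ultimately show False using G by (auto simp: undirected_tree_def)
  qed
  then have "G = ?H" using sub by (intro pair_pre_digraph.equality) auto
  with f_maps show thesis by (rule that)
qed

text \<open>Symmetry of \<open>E\<close> makes admissible parents equivalent to admissible arcs in
  both directions. The set of trees is independent of \<open>\<rho>\<close>, so any convenient
  vertex may serve as root for counting.\<close>

lemma bij_betw_tree_of_map:
  assumes V: "finite V" "\<rho> \<in> V" and E: "sym E"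
  shows "bij_betw (tree_of_map V \<rho>) (acyclic_maps (V - {\<rho>}) (\<lambda>v. {x \<in> V. (v, x) \<in> E}))
    {G. undirected_tree G \<and> pverts G = V \<and> parcs G \<subseteq> E}"
proof -
  have sub: "f \<in> acyclic_maps (V - {\<rho>}) (\<lambda>v. {x \<in> V. (v, x) \<in> E}) \<longleftrightarrow>
      f \<in> acyclic_maps (V - {\<rho>}) (\<lambda>_. V) \<and> parcs (tree_of_map V \<rho> f) \<subseteq> E" for f
    using symD[OF E] by (auto simp: acyclic_maps_def PiE_iff map_arcs_iff)
  show ?thesis
    unfolding bij_betw_def
  proof (intro conjI inj_onI equalityI subsetI)
    fix f g
    assume "f \<in> acyclic_maps (V - {\<rho>}) (\<lambda>v. {x \<in> V. (v, x) \<in> E})"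
      "g \<in> acyclic_maps (V - {\<rho>}) (\<lambda>v. {x \<in> V. (v, x) \<in> E})"
      "tree_of_map V \<rho> f = tree_of_map V \<rho> g"
    then show "f = g" using tree_of_map_inj[OF V(1)] unfolding sub by blast
  next
    fix G
    assume "G \<in> tree_of_map V \<rho> ` acyclic_maps (V - {\<rho>}) (\<lambda>v. {x \<in> V. (v, x) \<in> E})"
    then show "G \<in> {G. undirected_tree G \<and> pverts G = V \<and> parcs G \<subseteq> E}"
      using undirected_tree_tree_of_map[OF V] by (auto simp: sub simp del: tree_of_map_simps(2))
  next
    fix G
    assume G: "G \<in> {G. undirected_tree G \<and> pverts G = V \<and> parcs G \<subseteq> E}"
    then obtain f where "f \<in> acyclic_maps (V - {\<rho>}) (\<lambda>_. V)" "G = tree_of_map V \<rho> f"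
      using undirected_tree_eq_tree_of_map[of G \<rho>] V by auto
    then show "G \<in> tree_of_map V \<rho> ` acyclic_maps (V - {\<rho>}) (\<lambda>v. {x \<in> V. (v, x) \<in> E})"
      using G by (auto simp: sub simp del: tree_of_map_simps(2))
  qed
qed

section \<open>Counting embedded trees\<close>

text \<open>Read along a fixed enumeration \<open>ys\<close> of \<open>A\<close>, such maps are the
  arrangements of the multiset with \<open>N i\<close> copies of each \<open>i\<close>.\<close>

lemma card_maps_with_fibres:
  fixes N :: "'b \<Rightarrow> nat"
  assumes A: "finite A" and I: "finite I" and N: "(\<Sum>i\<in>I. N i) = card A"
  shows "card {a \<in> A \<rightarrow>\<^sub>E I. \<forall>i\<in>I. card {v \<in> A. a v = i} = N i} * (\<Prod>i\<in>I. fact (N i)) = fact (card A)"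
proof -
  define M where "M = (\<Sum>i\<in>I. replicate_mset (N i) i)"
  have count_M: "count M i = (if i \<in> I then N i else 0)" for i
    using I by (simp add: M_def count_sum)
  have size_M: "size M = card A"
    using N by (simp add: M_def)
  have set_M: "set_mset M \<subseteq> I"
    by (metis count_M count_eq_zero_iff subsetI)
  obtain ys where ys: "set ys = A" "distinct ys"
    using finite_distinct_list[OF A] by blast
  have count_map: "count (mset (map a ys)) i = card {v \<in> A. a v = i}" for a i
  proof -
    have "count (mset (map a ys)) i = length (filter (\<lambda>v. a v = i) ys)"
      by (induction ys) auto
    also have "\<dots> = card (set (filter (\<lambda>v. a v = i) ys))"
      using ys(2) by (metis distinct_card distinct_filter)
    finally show ?thesis using ys(1) by simp
  qed
  have "bij_betw (\<lambda>a. map a ys) {a \<in> A \<rightarrow>\<^sub>E I. \<forall>i\<in>I. card {v \<in> A. a v = i} = N i}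
      (permutations_of_multiset M)" (is "bij_betw ?h ?F _")
    unfolding bij_betw_def
  proof (intro conjI inj_onI equalityI subsetI)
    fix a b assume "a \<in> ?F" "b \<in> ?F" "map a ys = map b ys"
    then show "a = b" using ys(1) by (intro PiE_ext[of a A "\<lambda>_. I" b]) auto
  next
    fix xs assume "xs \<in> ?h ` ?F"
    then obtain a where a: "a \<in> ?F" "xs = map a ys" by auto
    have "mset xs = M"
    proof (rule multiset_eqI)
      fix i
      show "count (mset xs) i = count M i"
      proof (cases "i \<in> I")
        case False
        then have "{v \<in> A. a v = i} = {}" using a(1) by auto
        then have "card {v \<in> A. a v = i} = 0" by (simp only: card.empty)
        then show ?thesis unfolding a(2) count_map count_M using False by simp
      next
        case True
        then show ?thesis unfolding a(2) count_map count_M using a(1) by simp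
      qed
    qed
    then show "xs \<in> permutations_of_multiset M" by (simp add: permutations_of_multiset_def)
  next
    fix xs assume "xs \<in> permutations_of_multiset M"
    then have xs: "mset xs = M" by (simp add: permutations_of_multiset_def)
    then have len: "length ys = length xs"
      using size_M ys by (metis distinct_card size_mset)
    define a where "a = restrict (\<lambda>v. the (map_of (zip ys xs) v)) A"
    have a: "map a ys = xs"
      using len ys by (intro nth_equalityI) (auto simp: a_def map_of_zip_nth)
    have "a v \<in> I" if "v \<in> A" for v
    proof -
      have "a v \<in> set (map a ys)" using that ys(1) by simp
      then show ?thesis using a xs set_M by (metis set_mset_mset subsetD)
    qed
    moreover have "a \<in> extensional A" by (simp add: a_def)
    moreover have "card {v \<in> A. a v = i} = N i" if "i \<in> I" for i
      unfolding count_map[symmetric] a xs count_M using that by simp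
    ultimately show "xs \<in> ?h ` ?F" using a by (intro image_eqI[of _ _ a]) (auto simp: PiE_iff)
  qed
  then have "card ?F = card (permutations_of_multiset M)"
    by (rule bij_betw_same_card)
  \<comment> \<open>Indices with \<open>N i = 0\<close> are absent from \<open>M\<close> and
    contribute \<open>fact 0 = 1\<close>.\<close>
  moreover have "(\<Prod>i\<in>I. fact (N i)) = (\<Prod>i\<in>set_mset M. fact (count M i) :: nat)"
  proof (rule prod.mono_neutral_cong_right[OF I set_M])
    show "\<forall>i\<in>I - set_mset M. fact (N i) = (1 :: nat)"
      using count_M by (metis DiffE count_eq_zero_iff fact_0)
  qed (use set_M count_M in auto)
  ultimately show ?thesis
    using card_permutations_of_multiset_aux[of M] size_M by simp
qed

text \<open>The trees are oriented towards an auxiliary root of abscissa \<open>l\<close>, chosen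
  independently of the root at 0 of an embedded tree.\<close>

lemma trees_compatible_with_levels:
  fixes a :: "'a \<Rightarrow> int"
  defines "N \<equiv> \<lambda>V i. card {v \<in> V. a v = i}"
  assumes V: "finite V" "a ` V \<subseteq> {l..r}" "\<And>i. i \<in> {l..r} \<Longrightarrow> 0 < N V i" and lr: "l \<le> r"
  defines "\<T> \<equiv> {G. undirected_tree G \<and> pverts G = V \<and> parcs G \<subseteq> {(v, w). \<bar>a v - a w\<bar> = 1}}"
  shows "finite \<T>"
    and "N V l * N V r * card \<T> =
      (\<Prod>i=l..r. N V i) * (\<Prod>i=l..r. (N V (i - 1) + N V (i + 1)) ^ (N V i - 1))"
proof -
  have "{v \<in> V. a v = l} \<noteq> {}"
    using V(3)[of l] lr unfolding N_def by (metis atLeastAtMost_iff card.empty less_irrefl order_refl)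
  then obtain \<rho> where \<rho>: "\<rho> \<in> V" "a \<rho> = l" by auto
  let ?E = "{(v, w). \<bar>a v - a w\<bar> = 1}"
  let ?A = "acyclic_maps (V - {\<rho>}) (\<lambda>v. {x \<in> V. \<bar>a v - a x\<bar> = 1})"
  have "sym ?E" by (auto intro!: symI simp: abs_minus_commute)
  from bij_betw_tree_of_map[OF V(1) \<rho>(1) this]
  have bij: "bij_betw (tree_of_map V \<rho>) ?A \<T>" by (simp add: \<T>_def)
  have "?A \<subseteq> Pi\<^sub>E (V - {\<rho>}) (\<lambda>v. {x \<in> V. \<bar>a v - a x\<bar> = 1})" by (auto simp: acyclic_maps_def)
  moreover have "finite (Pi\<^sub>E (V - {\<rho>}) (\<lambda>v. {x \<in> V. \<bar>a v - a x\<bar> = 1}))"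
    using V(1) by (intro finite_PiE) auto
  ultimately have "finite ?A" by (rule finite_subset)
  then show "finite \<T>" using bij_betw_finite[OF bij] by simp
  show "N V l * N V r * card \<T> =
      (\<Prod>i=l..r. N V i) * (\<Prod>i=l..r. (N V (i - 1) + N V (i + 1)) ^ (N V i - 1))"
    using card_level_maps[OF V(1,2) V(3)[unfolded N_def] \<rho>] bij_betw_same_card[OF bij]
    by (simp add: N_def)
qed

text \<open>Positive fibres mean that \<open>l\<close> and \<open>r\<close> are attained, so the
  conditions on \<open>Min\<close> and \<open>Max\<close> amount to an inclusion.\<close>

lemma has_vertical_profile_iff:
  assumes "finite (pverts G)" "l \<le> r" "\<forall>i \<in> {l..r}. 0 < N i"
  shows "has_vertical_profile G a l r N \<longleftrightarrow>
    a ` pverts G \<subseteq> {l..r} \<and> (\<forall>i \<in> {l..r}. card {v \<in> pverts G. a v = i} = N i)"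
proof (cases "\<forall>i \<in> {l..r}. card {v \<in> pverts G. a v = i} = N i")
  case True
  have attained: "i \<in> a ` pverts G" if "i \<in> {l..r}" for i
  proof -
    have "card {v \<in> pverts G. a v = i} \<noteq> 0" using True assms(3) that by auto
    then have "{v \<in> pverts G. a v = i} \<noteq> {}" by (metis card.empty)
    then show ?thesis by auto
  qed
  have "Min (a ` pverts G) = l \<and> Max (a ` pverts G) = r \<longleftrightarrow> a ` pverts G \<subseteq> {l..r}"
  proof
    assume "a ` pverts G \<subseteq> {l..r}"
    then show "Min (a ` pverts G) = l \<and> Max (a ` pverts G) = r"
      using attained[of l] attained[of r] assms(1,2)
      by (intro conjI Min_eqI Max_eqI) auto
  next
    assume "Min (a ` pverts G) = l \<and> Max (a ` pverts G) = r"
    then show "a ` pverts G \<subseteq> {l..r}" using assms(1) by auto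
  qed
  then show ?thesis using True by (simp add: has_vertical_profile_def)
qed (auto simp: has_vertical_profile_def)

lemma card_eq_sum_fibres:
  assumes "finite V" "finite I" "a ` V \<subseteq> I"
  shows "card V = (\<Sum>i\<in>I. card {v \<in> V. a v = i})"
  using sum.group[OF assms, of "\<lambda>_. 1 :: nat"] by simp

theorem theorem1p2:
  fixes l r :: int and N :: "int \<Rightarrow> nat" and n :: nat
  assumes "l \<le> 0" and "0 \<le> r"
    and "\<forall>i \<in> {l..r}. 0 < N i"
    and "N (l - 1) = 0" and "N (r + 1) = 0"
    and "n = (\<Sum>i = l..r. N i)"
  defines "T \<equiv> {((G, \<rho>), a) \<in> embedded_rooted_cayley_trees. has_vertical_profile G a l r N}"
  shows "finite T \<and>
    real (card T) =
      real (N 0) / (real (N l) * real (N r)) *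
      (fact n / (\<Prod>i = l..r. fact (N i - 1))) *
      (\<Prod>i = l..r. real (N (i - 1) + N (i + 1)) ^ (N i - 1))"
proof -
  define V where "V = {1..n}"
  define Labs where "Labs = {a \<in> V \<rightarrow>\<^sub>E {l..r}. \<forall>i\<in>{l..r}. card {v \<in> V. a v = i} = N i}"
  define trees where "trees a = {G. undirected_tree G \<and> pverts G = V \<and>
    parcs G \<subseteq> {(v, w). \<bar>a v - a w\<bar> = 1}}" for a :: "nat \<Rightarrow> int"
  define roots where "roots a = {v \<in> V. a v = 0}" for a :: "nat \<Rightarrow> int"
  define \<tau> where "\<tau> = (\<Prod>i=l..r. N i) * (\<Prod>i=l..r. (N (i - 1) + N (i + 1)) ^ (N i - 1))"
  have lr: "l \<le> r" using assms by simp
  have finV: "finite V" by (simp add: V_def)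
  \<comment> \<open>Once the abscissa map is fixed, the tree and the root are independent choices,
    which gives a product.\<close>
  have T_eq: "T = (\<lambda>(a, G, \<rho>). ((G, \<rho>), a)) ` (SIGMA a:Labs. trees a \<times> roots a)"
  proof -
    have "((G, \<rho>), a) \<in> T \<longleftrightarrow> a \<in> Labs \<and> G \<in> trees a \<and> \<rho> \<in> roots a" for G \<rho> a
    proof
      assume "((G, \<rho>), a) \<in> T"
      then obtain n' where tree: "undirected_tree G" and G: "pverts G = {1..n'}" and \<rho>: "\<rho> \<in> pverts G"
        and emb: "a \<in> extensional (pverts G)" "a \<rho> = 0" "\<forall>(v, w)\<in>parcs G. \<bar>a v - a w\<bar> = 1"
        and prof: "has_vertical_profile G a l r N"
        by (auto simp: T_def embedded_rooted_cayley_trees_def rooted_cayley_tree_def tree_embedding_def)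
      have prof': "a ` pverts G \<subseteq> {l..r}" "\<forall>i\<in>{l..r}. card {v \<in> pverts G. a v = i} = N i"
        using prof has_vertical_profile_iff[of G l r N a] G lr assms(3) by auto
      \<comment> \<open>The size is existential in \<open>embedded_rooted_cayley_trees\<close>; the
        profile determines it.\<close>
      have "card (pverts G) = n"
        using card_eq_sum_fibres[of "pverts G" "{l..r}" a] prof' G assms(6) by simp
      then have "pverts G = V" using G by (simp add: V_def)
      then show "a \<in> Labs \<and> G \<in> trees a \<and> \<rho> \<in> roots a"
        using tree \<rho> emb prof' by (auto simp: Labs_def trees_def roots_def PiE_iff)
    next
      assume "a \<in> Labs \<and> G \<in> trees a \<and> \<rho> \<in> roots a"
      then have tree: "undirected_tree G" and G: "pverts G = V" and \<rho>: "\<rho> \<in> V"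
        and emb: "a \<in> extensional V" "a \<rho> = 0" "\<forall>(v, w)\<in>parcs G. \<bar>a v - a w\<bar> = 1"
        and prof: "a ` V \<subseteq> {l..r}" "\<forall>i\<in>{l..r}. card {v \<in> V. a v = i} = N i"
        by (auto simp: Labs_def trees_def roots_def PiE_iff)
      have "has_vertical_profile G a l r N"
        using has_vertical_profile_iff[of G l r N a] prof G finV lr assms(3) by simp
      moreover have "rooted_cayley_tree n G \<rho>"
        using tree G \<rho> by (simp add: rooted_cayley_tree_def V_def)
      moreover have "tree_embedding G \<rho> a"
        using emb G by (simp add: tree_embedding_def)
      ultimately show "((G, \<rho>), a) \<in> T"
        by (auto simp: T_def embedded_rooted_cayley_trees_def)
    qed
    then show ?thesis by (auto simp: image_iff)
  qed
  have card_roots: "card (roots a) = N 0" if "a \<in> Labs" for a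
    using that assms(1,2) by (simp add: Labs_def roots_def)
  have trees: "finite (trees a)" "N l * N r * card (trees a) = \<tau>" if a: "a \<in> Labs" for a
  proof -
    have img: "a ` V \<subseteq> {l..r}" using a by (auto simp: Labs_def)
    have fib: "card {v \<in> V. a v = i} = N i" if "i \<in> {l..r}" for i
      using a that by (auto simp: Labs_def)
    have pos: "0 < card {v \<in> V. a v = i}" if "i \<in> {l..r}" for i
      using fib[OF that] assms(3) that by simp
    \<comment> \<open>The factors at levels \<open>l\<close> and \<open>r\<close> read
      \<open>N\<close> one step outside the range, where the fibres are empty.\<close>
    have out: "card {v \<in> V. a v = i} = N i" if "i = l - 1 \<or> i = r + 1" for i
    proof -
      have "{v \<in> V. a v = i} = {}" using img that by force
      then have "card {v \<in> V. a v = i} = 0" by (simp only: card.empty)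
      then show ?thesis using assms(4,5) that by auto
    qed
    have fib': "card {v \<in> V. a v = i} = N i" if "i \<in> {l-1..r+1}" for i
      using fib[of i] out[of i] that by fastforce
    note main = trees_compatible_with_levels[of V a l r, OF finV img pos lr, folded trees_def]
    show "finite (trees a)" by (rule main(1))
    have "(\<Prod>i=l..r. card {v \<in> V. a v = i}) = (\<Prod>i=l..r. N i)"
      by (intro prod.cong refl) (simp add: fib)
    moreover have "(\<Prod>i=l..r. (card {v \<in> V. a v = i - 1} + card {v \<in> V. a v = i + 1}) ^ (card {v \<in> V. a v = i} - 1)) =
        (\<Prod>i=l..r. (N (i - 1) + N (i + 1)) ^ (N i - 1))"
      by (intro prod.cong refl) (simp add: fib')
    ultimately show "N l * N r * card (trees a) = \<tau>"
      using main(2) fib[of l] fib[of r] lr by (simp add: \<tau>_def)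
  qed
  have pos: "N l \<noteq> 0" "N r \<noteq> 0" using assms(3) lr by auto
  have finL: "finite Labs"
    unfolding Labs_def using finV by (auto intro: finite_PiE finite_subset[rotated])
  have finS: "finite (SIGMA a:Labs. trees a \<times> roots a)"
    using finL trees(1) finV by (intro finite_SigmaI) (auto simp: roots_def)
  have "card T = card (SIGMA a:Labs. trees a \<times> roots a)"
    unfolding T_eq by (rule card_image) (auto intro: inj_onI)
  also have "\<dots> = (\<Sum>a\<in>Labs. card (trees a) * N 0)"
    using finL trees(1) finV card_roots by (subst card_SigmaI) (auto simp: roots_def card_cartesian_product)
  \<comment> \<open>Each tree count is known only through its multiple by \<open>N l * N r\<close>;
    division waits until the passage to the reals.\<close>
  finally have "N l * N r * card T = (\<Sum>a\<in>Labs. N l * N r * card (trees a) * N 0)"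
    by (simp add: sum_distrib_left algebra_simps)
  also have "\<dots> = card Labs * (\<tau> * N 0)"
    using trees(2) by simp
  finally have "real (N l) * real (N r) * real (card T) = real (card Labs) * (real \<tau> * real (N 0))"
    by (metis of_nat_mult)
  then have cardT: "real (card T) = real (card Labs) * real \<tau> * real (N 0) / (real (N l) * real (N r))"
    using pos by (simp add: field_simps)
  have "card Labs * (\<Prod>i=l..r. fact (N i)) = fact n"
    using card_maps_with_fibres[OF finV, of "{l..r}" N] assms(6) by (simp add: Labs_def V_def)
  then have "real (card Labs) * (\<Prod>i=l..r. fact (N i)) = fact n"
    by (metis (mono_tags, lifting) of_nat_fact of_nat_mult of_nat_prod prod.cong)
  \<comment> \<open>The product of the \<open>N i\<close> contained in \<open>\<tau>\<close> cancels
    one factor of each factorial, which leaves \<open>fact (N i - 1)\<close>.\<close>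
  moreover have "(\<Prod>i=l..r. fact (N i)) = (\<Prod>i=l..r. real (N i)) * (\<Prod>i=l..r. fact (N i - 1) :: real)"
    unfolding prod.distrib[symmetric] using assms(3) by (intro prod.cong refl) (simp add: fact_reduce)
  ultimately have labs: "real (card Labs) * (\<Prod>i=l..r. real (N i)) = fact n / (\<Prod>i=l..r. fact (N i - 1))"
    by (simp add: field_simps)
  have "real (card T) = real (N 0) / (real (N l) * real (N r)) *
      (fact n / (\<Prod>i = l..r. fact (N i - 1))) *
      (\<Prod>i = l..r. real (N (i - 1) + N (i + 1)) ^ (N i - 1))"
    unfolding cardT \<tau>_def labs[symmetric] by (simp add: algebra_simps)
  then show ?thesis unfolding T_eq using finS by blast
qed

end
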